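(* Let $r\geq 1$ and let $n_1,\ldots,n_r$ be positive integers, $N=n_1+\cdots+n_r$, $K$ a field, $S=K[x_1,\ldots,x_N]$, and $$I=(x_1,\ldots,x_{n_1})\cap(x_{n_1+1},\ldots,x_{n_1+n_2})\cap\cdots\cap(x_{n_1+\cdots+n_{r-1}+1},\ldots,x_N)\subset S.$$ Then $$\operatorname{hdepth}(S/I)\leq \min\left\{d\geq r\;:\;\binom{N-d+r-1}{r}<n_1n_2\cdots n_r\right\}-1.$$
   Context: Here $d$ ranges over integers, and $\binom{x}{k}=\frac{x(x-1)\cdots(x-k+1)}{k!}$ for any integer $x$ and integer $k\ge 0$. Hilbert depth: let $S=K[x_1,\ldots,x_p]$. For a finitely generated graded $S$-module $M$, $\operatorname{hdepth}(M)$ is the maximal depth of a finitely generated graded $S$-module with the same Hilbert series as $M$. For squarefree monomial ideals $A\subset B\subset S$ this is (by a known theorem, usable as the definition) $\operatorname{hdepth}(B/A)=\max\{d\in\{0,\ldots,p\}:\beta_k^d(B/A)\geq 0\text{ for all }0\leq k\leq d\}$, where $\beta_k^d(B/A)=\sum_{j=0}^k(-1)^{k-j}\binom{d-j}{k-j}\alpha_j(B/A)$ and $\alpha_j(B/A)$ is the number of squarefree monomials of degree $j$ in $B\setminus A$. *)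

theory Defs
  imports Complex_Main "HOL-Library.Poly_Mapping" "HOL-Algebra.Ideal"
begin

text \<open>
  A monomial is its finitely supported exponent vector \<open>nat \<Rightarrow>\<^sub>0 nat\<close>, and a polynomial is a
  finitely supported map from monomials to coefficients, with the convolution product of
  \<open>Poly_Mapping\<close>. That type has one variable for every natural number; \<open>polynomial_ring p\<close> is
  the ring $K[x_1,\ldots,x_p]$, of those polynomials involving only the variables
  \<open>1, \<dots>, p\<close>.
\<close>

type_synonym monomial = "nat \<Rightarrow>\<^sub>0 nat"
type_synonym 'k mpoly = "monomial \<Rightarrow>\<^sub>0 'k"

definition polynomial_ring :: "nat \<Rightarrow> ('k::field) mpoly ring" where
  "polynomial_ring p =
     \<lparr>carrier = {f. \<forall>m\<in>Poly_Mapping.keys f. Poly_Mapping.keys m \<subseteq> {1..p}},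
      monoid.mult = (*), one = 1, zero = 0, add = (+)\<rparr>"

definition monomial_poly :: "monomial \<Rightarrow> ('k::field) mpoly" where
  "monomial_poly m = Poly_Mapping.single m 1"

definition X :: "nat \<Rightarrow> ('k::field) mpoly" where
  "X i = monomial_poly (Poly_Mapping.single i 1)"

definition mdegree :: "monomial \<Rightarrow> nat" where
  "mdegree m = (\<Sum>i\<in>Poly_Mapping.keys m. Poly_Mapping.lookup m i)"

definition squarefree_monomial :: "monomial \<Rightarrow> bool" where
  "squarefree_monomial m \<longleftrightarrow> (\<forall>i. Poly_Mapping.lookup m i \<le> 1)"

text \<open>
  The functions below take the number \<open>p\<close> of variables and subsets \<open>B\<close>, \<open>A\<close> of
  \<open>polynomial_ring p\<close>. They carry the meaning of invariants of the module \<open>B/A\<close> when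
  \<open>A \<subset> B\<close> are squarefree monomial ideals. The Hilbert depth is given by its known
  combinatorial characterization in terms of the numbers \<open>\<beta>\<close>; the maximum exists because
  \<open>d = 0\<close> always qualifies. \<open>beta p B A d k\<close> is meant, and only used, for
  \<open>k \<le> d\<close>, where the subtractions of natural numbers do not truncate.
\<close>

definition alpha :: "nat \<Rightarrow> ('k::field) mpoly set \<Rightarrow> 'k mpoly set \<Rightarrow> nat \<Rightarrow> nat" where
  "alpha p B A j =
     card {m. Poly_Mapping.keys m \<subseteq> {1..p} \<and> squarefree_monomial m \<and> mdegree m = j \<and> monomial_poly m \<in> B - A}"

definition beta :: "nat \<Rightarrow> ('k::field) mpoly set \<Rightarrow> 'k mpoly set \<Rightarrow> nat \<Rightarrow> nat \<Rightarrow> int" where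
  "beta p B A d k =
     (\<Sum>j=0..k. (-1) ^ (k - j) * int ((d - j) choose (k - j)) * int (alpha p B A j))"

definition hdepth :: "nat \<Rightarrow> ('k::field) mpoly set \<Rightarrow> 'k mpoly set \<Rightarrow> nat" where
  "hdepth p B A = Max {d \<in> {0..p}. \<forall>k\<in>{0..d}. beta p B A d k \<ge> 0}"

definition block :: "(nat \<Rightarrow> nat) \<Rightarrow> nat \<Rightarrow> nat set" where
  "block n i = {(\<Sum>l=1..<i. n l) + 1 .. (\<Sum>l=1..i. n l)}"

text \<open>
  The ring axioms matter for the meaning of \<open>Idl\<close>, which is an intersection of ideals.
\<close>

lemma cring_polynomial_ring: "cring (polynomial_ring p :: ('k::field) mpoly ring)"
proof -
  define C where "C = {f :: 'k mpoly. \<forall>m\<in>Poly_Mapping.keys f. Poly_Mapping.keys m \<subseteq> {1..p}}"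
  have R: "(polynomial_ring p :: 'k mpoly ring) =
      \<lparr>carrier = C, monoid.mult = (*), one = 1, zero = 0, add = (+)\<rparr>"
    by (simp only: polynomial_ring_def C_def)
  have zero: "0 \<in> C" and one: "1 \<in> C"
    by (simp_all add: C_def)
  have add: "f + g \<in> C" if "f \<in> C" "g \<in> C" for f g
    using that Poly_Mapping.keys_add[of f g] unfolding C_def by blast
  have mult: "f * g \<in> C" if f: "f \<in> C" and g: "g \<in> C" for f g
  proof -
    have "Poly_Mapping.keys m \<subseteq> {1..p}" if m: "m \<in> Poly_Mapping.keys (f * g)" for m
    proof -
      obtain a b where a: "a \<in> Poly_Mapping.keys f" and b: "b \<in> Poly_Mapping.keys g"
        and m_eq: "m = a + b"
        using Poly_Mapping.keys_mult[of f g] m by blast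
      have "Poly_Mapping.keys a \<subseteq> {1..p}" "Poly_Mapping.keys b \<subseteq> {1..p}"
        using f g a b unfolding C_def by simp_all
      then show ?thesis
        unfolding m_eq using Poly_Mapping.keys_add[of a b] by (meson Un_least order_trans)
    qed
    then show ?thesis
      by (simp add: C_def)
  qed
  have uminus: "- f \<in> C" if "f \<in> C" for f
    using that by (simp add: C_def)
  have grp: "abelian_group (polynomial_ring p :: 'k mpoly ring)"
    unfolding R
  proof (rule abelian_groupI, goal_cases)
    case (6 f)
    then show ?case
      using uminus[of f] by (intro bexI[of _ "- f"]) simp_all
  qed (simp_all add: zero add ac_simps)
  have mon: "comm_monoid (polynomial_ring p :: 'k mpoly ring)"
    unfolding R by (rule comm_monoidI) (simp_all add: one mult ac_simps)
  show ?thesis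
    by (rule cringI[OF grp mon]) (simp add: R distrib_right)
qed

end

(* Fewer than r variables cannot meet all r blocks, so S/I has the same squarefree monomials as S
   in each degree below r, while in degree r the squarefree monomials of I are the n_1 ... n_r
   transversals of the blocks. Hence beta_r^d(S/I) = binom(N-d+r-1, r) - n_1 ... n_r, which for
   d <= N is decreasing in d. *)

theory Submission
  imports Defs "HOL-Library.Disjoint_Sets" "HOL-Computational_Algebra.Formal_Power_Series"
begin

section \<open>Monomials in ideals generated by variables\<close>

lemma keys_add_nat:
  fixes a b :: "'a \<Rightarrow>\<^sub>0 nat"
  shows "Poly_Mapping.keys (a + b) = Poly_Mapping.keys a \<union> Poly_Mapping.keys b"
  by (auto simp: in_keys_iff lookup_add)

lemma carrier_polynomial_ring_iff:
  "f \<in> carrier (polynomial_ring p) \<longleftrightarrow> (\<forall>m\<in>Poly_Mapping.keys f. Poly_Mapping.keys m \<subseteq> {1..p})"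
  by (simp add: polynomial_ring_def)

lemma polynomial_ring_simps:
  "monoid.mult (polynomial_ring p) = (*)"
  "one (polynomial_ring p) = 1"
  "zero (polynomial_ring p) = 0"
  "add (polynomial_ring p) = (+)"
  by (simp_all add: polynomial_ring_def)

lemma monomial_poly_in_carrier:
  "Poly_Mapping.keys m \<subseteq> {1..p} \<Longrightarrow> (monomial_poly m :: 'k::field mpoly) \<in> carrier (polynomial_ring p)"
  by (simp add: carrier_polynomial_ring_iff monomial_poly_def)

text \<open>Uniqueness of additive inverses identifies the inverse of the ring structure with the
  negation of the type.\<close>

lemma a_inv_polynomial_ring:
  fixes f :: "'k::field mpoly"
  assumes "f \<in> carrier (polynomial_ring p)"
  shows "a_inv (polynomial_ring p) f = - f"
proof -
  interpret cring "polynomial_ring p :: 'k mpoly ring" by (rule cring_polynomial_ring)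
  have "- f \<in> carrier (polynomial_ring p)"
    using assms by (simp add: carrier_polynomial_ring_iff)
  then show ?thesis
    using assms by (intro minus_equality) (simp_all add: polynomial_ring_simps)
qed

text \<open>Exponents are natural numbers and cannot cancel, so multiplying monomials only enlarges
  supports and the condition survives products. For \<open>V\<close> inside \<open>{1..p}\<close>
  this ideal contains every \<open>X i\<close> with \<open>i\<close> in \<open>V\<close>, hence
  bounds the ideal they generate from above.\<close>

lemma ideal_monomials_meeting:
  "ideal {f \<in> carrier (polynomial_ring p). \<forall>m\<in>Poly_Mapping.keys f. Poly_Mapping.keys m \<inter> V \<noteq> {}}
     (polynomial_ring p :: 'k::field mpoly ring)" (is "ideal ?J ?R")
proof -
  interpret cring ?R by (rule cring_polynomial_ring)
  have sub: "?J \<subseteq> carrier ?R" by blast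
  have add: "f + g \<in> ?J" if "f \<in> ?J" "g \<in> ?J" for f g
  proof -
    have "f + g \<in> carrier ?R"
      using add.m_closed[of f g] that by (simp add: polynomial_ring_simps)
    then show ?thesis
      using that Poly_Mapping.keys_add[of f g] by blast
  qed
  have uminus: "- f \<in> ?J" if "f \<in> ?J" for f
    using that by (simp add: carrier_polynomial_ring_iff)
  have mult: "g * f \<in> ?J" if f: "f \<in> ?J" and g: "g \<in> carrier ?R" for f g
  proof -
    have "g * f \<in> carrier ?R"
      using m_closed[of g f] that by (simp add: polynomial_ring_simps)
    moreover have "Poly_Mapping.keys m \<inter> V \<noteq> {}" if m: "m \<in> Poly_Mapping.keys (g * f)" for m
    proof -
      obtain a b where "b \<in> Poly_Mapping.keys f" "m = a + b"
        using Poly_Mapping.keys_mult[of g f] m by blast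
      then show ?thesis
        using f by (auto simp: keys_add_nat)
    qed
    ultimately show ?thesis by blast
  qed
  have zero: "0 \<in> ?J"
    by (simp add: carrier_polynomial_ring_iff)
  show ?thesis
  proof (rule idealI)
    show "ring ?R" by (rule ring_axioms)
    show "subgroup ?J (add_monoid ?R)"
    proof (rule add.subgroupI)
      show "?J \<subseteq> carrier ?R" by (rule sub)
      show "?J \<noteq> {}" using zero by blast
      fix f assume f: "f \<in> ?J"
      then have "\<ominus>\<^bsub>?R\<^esub> f = - f"
        using sub by (intro a_inv_polynomial_ring) blast
      then show "\<ominus>\<^bsub>?R\<^esub> f \<in> ?J"
        using uminus[OF f] by (simp only:)
      fix g assume "g \<in> ?J"
      then show "f \<oplus>\<^bsub>?R\<^esub> g \<in> ?J"
        using add[OF f] by (simp only: polynomial_ring_simps)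
    qed
  next
    fix f g assume "f \<in> ?J" "g \<in> carrier ?R"
    then show "g \<otimes>\<^bsub>?R\<^esub> f \<in> ?J"
      unfolding polynomial_ring_simps by (rule mult)
  next
    fix f g assume "f \<in> ?J" "g \<in> carrier ?R"
    then show "f \<otimes>\<^bsub>?R\<^esub> g \<in> ?J"
      unfolding polynomial_ring_simps by (subst mult.commute) (rule mult)
  qed
qed

lemma X_in_carrier:
  "i \<in> {1..p} \<Longrightarrow> (X i :: 'k::field mpoly) \<in> carrier (polynomial_ring p)"
  unfolding X_def by (rule monomial_poly_in_carrier) simp

text \<open>The generated ideal is the least one containing its generators, so
  \<open>ideal_monomials_meeting\<close> gives one direction. For the other, a variable of
  \<open>V\<close> dividing the monomial is split off as a factor.\<close>

lemma monomial_poly_mem_genideal_iff: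
  assumes V: "V \<subseteq> {1..p}" and m: "Poly_Mapping.keys m \<subseteq> {1..p}"
  shows "(monomial_poly m :: 'k::field mpoly) \<in> Idl\<^bsub>polynomial_ring p\<^esub> (X ` V)
           \<longleftrightarrow> Poly_Mapping.keys m \<inter> V \<noteq> {}" (is "_ \<in> genideal ?R _ \<longleftrightarrow> _")
proof
  interpret cring ?R by (rule cring_polynomial_ring)
  have XV: "(X ` V :: 'k mpoly set) \<subseteq> carrier ?R"
    using V X_in_carrier by blast
  {
    assume mem: "(monomial_poly m :: 'k mpoly) \<in> Idl\<^bsub>?R\<^esub> (X ` V)"
    have "Idl\<^bsub>?R\<^esub> (X ` V)
        \<subseteq> {f \<in> carrier ?R. \<forall>m\<in>Poly_Mapping.keys f. Poly_Mapping.keys m \<inter> V \<noteq> {}}"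
      using XV by (intro genideal_minimal ideal_monomials_meeting)
        (auto simp: X_def monomial_poly_def)
    then show "Poly_Mapping.keys m \<inter> V \<noteq> {}"
      using mem by (auto simp: monomial_poly_def)
  next
    assume "Poly_Mapping.keys m \<inter> V \<noteq> {}"
    then obtain i where i: "i \<in> Poly_Mapping.keys m" "i \<in> V" by blast
    \<comment> \<open>The cofactor of \<open>X i\<close>. Truncated subtraction loses nothing here,
      since \<open>i\<close> occurs in \<open>m\<close> with exponent at least 1.\<close>
    define m' where "m' = m - Poly_Mapping.single i 1"
    have m_eq: "m = m' + Poly_Mapping.single i 1"
      using i(1) by (intro poly_mapping_eqI)
        (auto simp: m'_def lookup_add lookup_minus lookup_single when_def in_keys_iff)
    have "Poly_Mapping.keys m' \<subseteq> {1..p}"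
      using m unfolding m_eq keys_add_nat by simp
    then have "(monomial_poly m' :: 'k mpoly) \<in> carrier ?R"
      by (rule monomial_poly_in_carrier)
    moreover have "(X i :: 'k mpoly) \<in> Idl\<^bsub>?R\<^esub> (X ` V)"
      using genideal_self[OF XV] i by blast
    ultimately have "monomial_poly m' * (X i :: 'k mpoly) \<in> Idl\<^bsub>?R\<^esub> (X ` V)"
      using ideal.I_l_closed[OF genideal_ideal[OF XV]] by (simp add: polynomial_ring_simps)
    then show "(monomial_poly m :: 'k mpoly) \<in> Idl\<^bsub>?R\<^esub> (X ` V)"
      unfolding m_eq by (simp add: X_def monomial_poly_def mult_single)
  }
qed

section \<open>Squarefree monomials as finite sets of variables\<close>

lemma lookup_squarefree_monomial:
  "squarefree_monomial m \<Longrightarrow> Poly_Mapping.lookup m i = (if i \<in> Poly_Mapping.keys m then 1 else 0)"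
  unfolding squarefree_monomial_def in_keys_iff by (metis One_nat_def le_Suc_eq le_zero_eq)

lemma mdegree_squarefree:
  "squarefree_monomial m \<Longrightarrow> mdegree m = card (Poly_Mapping.keys m)"
  by (simp add: mdegree_def lookup_squarefree_monomial)

lemma squarefree_monomial_exists:
  assumes "finite T"
  shows "\<exists>m. squarefree_monomial m \<and> Poly_Mapping.keys m = T"
proof -
  let ?m = "Abs_poly_mapping (\<lambda>i. if i \<in> T then 1 else 0 :: nat)"
  have "Poly_Mapping.lookup ?m = (\<lambda>i. if i \<in> T then 1 else 0)"
    using assms by (intro lookup_Abs_poly_mapping) simp
  then have "squarefree_monomial ?m \<and> Poly_Mapping.keys ?m = T"
    by (auto simp: squarefree_monomial_def in_keys_iff split: if_splits)
  then show ?thesis ..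
qed

text \<open>A squarefree monomial is determined by its support, whose size is its degree, and every
  finite set is such a support. The predicate \<open>P\<close> serves to carry ideal membership over
  to sets.\<close>

lemma card_squarefree_monomials:
  assumes "finite A"
  shows "card {m. Poly_Mapping.keys m \<subseteq> A \<and> squarefree_monomial m \<and> mdegree m = j
                  \<and> P (Poly_Mapping.keys m)}
       = card {T. T \<subseteq> A \<and> card T = j \<and> P T}"
proof (rule bij_betw_same_card[where f = Poly_Mapping.keys], rule bij_betw_imageI)
  show "inj_on Poly_Mapping.keys {m. Poly_Mapping.keys m \<subseteq> A \<and> squarefree_monomial m
      \<and> mdegree m = j \<and> P (Poly_Mapping.keys m)}"
    by (auto intro!: inj_onI poly_mapping_eqI simp: lookup_squarefree_monomial)
  show "Poly_Mapping.keys ` {m. Poly_Mapping.keys m \<subseteq> A \<and> squarefree_monomial m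
      \<and> mdegree m = j \<and> P (Poly_Mapping.keys m)} = {T. T \<subseteq> A \<and> card T = j \<and> P T}" (is "?L = ?R")
  proof
    show "?L \<subseteq> ?R"
      by (auto simp: mdegree_squarefree)
    show "?R \<subseteq> ?L"
    proof
      fix T assume T: "T \<in> ?R"
      then obtain m where "squarefree_monomial m" "Poly_Mapping.keys m = T"
        using squarefree_monomial_exists[of T] assms finite_subset by blast
      then show "T \<in> ?L"
        using T by (auto simp: mdegree_squarefree)
    qed
  qed
qed

text \<open>A monomial is outside the intersection as soon as it is outside one of the ideals, which
  happens exactly when its support misses the corresponding \<open>F i\<close>.\<close>

lemma alpha_intersection_of_primes:
  fixes F :: "nat \<Rightarrow> nat set" and L :: "nat set"
  assumes "\<And>i. i \<in> L \<Longrightarrow> F i \<subseteq> {1..p}"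
  shows "alpha p (carrier (polynomial_ring p :: 'k::field mpoly ring))
           (\<Inter>i\<in>L. Idl\<^bsub>polynomial_ring p\<^esub> (X ` F i)) j
       = card {T. T \<subseteq> {1..p} \<and> card T = j \<and> (\<exists>i\<in>L. T \<inter> F i = {})}"
proof -
  have "(monomial_poly m :: 'k mpoly) \<in> carrier (polynomial_ring p)
              - (\<Inter>i\<in>L. Idl\<^bsub>polynomial_ring p\<^esub> (X ` F i))
          \<longleftrightarrow> (\<exists>i\<in>L. Poly_Mapping.keys m \<inter> F i = {})" if m: "Poly_Mapping.keys m \<subseteq> {1..p}" for m
    using monomial_poly_mem_genideal_iff[OF assms m] monomial_poly_in_carrier[OF m] by blast
  then have "{m. Poly_Mapping.keys m \<subseteq> {1..p} \<and> squarefree_monomial m \<and> mdegree m = j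
          \<and> (monomial_poly m :: 'k mpoly) \<in> carrier (polynomial_ring p)
              - (\<Inter>i\<in>L. Idl\<^bsub>polynomial_ring p\<^esub> (X ` F i))}
      = {m. Poly_Mapping.keys m \<subseteq> {1..p} \<and> squarefree_monomial m \<and> mdegree m = j
          \<and> (\<exists>i\<in>L. Poly_Mapping.keys m \<inter> F i = {})}"
    by (intro Collect_cong) (metis (no_types, lifting))
  then show ?thesis
    by (simp add: alpha_def card_squarefree_monomials[where P = "\<lambda>T. \<exists>i\<in>L. T \<inter> F i = {}"])
qed

section \<open>Sets that meet every member of a disjoint family\<close>

lemma card_ge_if_meets_disjoint:
  assumes "finite L" "finite T" "disjoint_family_on F L" "\<And>i. i \<in> L \<Longrightarrow> T \<inter> F i \<noteq> {}"
  shows "card L \<le> card T"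
proof -
  have "\<forall>i\<in>L. \<exists>x. x \<in> T \<inter> F i"
    using assms(4) by blast
  then obtain f where f: "\<And>i. i \<in> L \<Longrightarrow> f i \<in> T \<inter> F i"
    by metis
  \<comment> \<open>Points chosen in different members are distinct by disjointness.\<close>
  have "inj_on f L"
    using f assms(3) by (intro inj_onI) (fastforce simp: disjoint_family_on_def)
  then show ?thesis
    using f assms(2) by (intro card_inj_on_le[of f]) auto
qed

text \<open>The image of \<open>L\<close> under a choice function is a transversal of the right
  size, and disjointness lets the function be recovered from it. A lower bound is the useful
  direction, since the transversals enter \<open>beta\<close> with a minus sign.\<close>

lemma card_transversals_ge:
  assumes "finite L" "finite A" "disjoint_family_on F L" and sub: "\<And>i. i \<in> L \<Longrightarrow> F i \<subseteq> A"
  shows "(\<Prod>i\<in>L. card (F i)) \<le> card {T. T \<subseteq> A \<and> card T = card L \<and> (\<forall>i\<in>L. T \<inter> F i \<noteq> {})}"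
proof -
  have unique: "i = j" if "x \<in> F i" "x \<in> F j" "i \<in> L" "j \<in> L" for x i j
    using that assms(3) by (auto simp: disjoint_family_on_def)
  have "inj_on (\<lambda>f. f ` L) (PiE L F)"
  proof (rule inj_onI)
    fix f g assume f: "f \<in> PiE L F" and g: "g \<in> PiE L F" and eq: "f ` L = g ` L"
    have "f i = g i" if i: "i \<in> L" for i
    proof -
      \<comment> \<open>The common point \<open>f i = g j\<close> lies in both \<open>F i\<close>
        and \<open>F j\<close>, which forces \<open>i = j\<close>.\<close>
      obtain j where "j \<in> L" "f i = g j"
        using eq i by blast
      then show ?thesis
        using unique PiE_mem[OF f i] PiE_mem[OF g] i by metis
    qed
    then show "f = g"
      using f g by (rule PiE_ext[rotated 2])
  qed
  moreover have "(\<lambda>f. f ` L) ` PiE L F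
      \<subseteq> {T. T \<subseteq> A \<and> card T = card L \<and> (\<forall>i\<in>L. T \<inter> F i \<noteq> {})}"
  proof (rule image_subsetI)
    fix f assume f: "f \<in> PiE L F"
    have "inj_on f L"
      by (rule inj_onI) (metis unique PiE_mem[OF f])
    then show "f ` L \<in> {T. T \<subseteq> A \<and> card T = card L \<and> (\<forall>i\<in>L. T \<inter> F i \<noteq> {})}"
      using PiE_mem[OF f] sub by (auto simp: card_image)
  qed
  moreover have "finite {T. T \<subseteq> A \<and> card T = card L \<and> (\<forall>i\<in>L. T \<inter> F i \<noteq> {})}"
    using assms(2) by simp
  ultimately have "card (PiE L F)
      \<le> card {T. T \<subseteq> A \<and> card T = card L \<and> (\<forall>i\<in>L. T \<inter> F i \<noteq> {})}"
    by (rule card_inj_on_le)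
  then show ?thesis
    using assms(1) by (simp add: card_PiE)
qed

section \<open>Evaluating the alternating sum that defines \<open>beta\<close>\<close>

lemma alternating_binomial_convolution:
  assumes "k \<le> d"
  shows "(\<Sum>j=0..k. (-1) ^ (k - j) * of_nat ((d - j) choose (k - j)) * of_nat (N choose j))
       = ((of_nat N - of_nat d + of_nat k - 1 :: 'a::field_char_0) gchoose k)"
proof -
  \<comment> \<open>Upper negation turns \<open>d - j\<close> into
    \<open>(k - j) - (d - j) - 1 = k - d - 1\<close>, which no longer depends on \<open>j\<close>,
    as the Vandermonde convolution requires. This number is negative, hence the generalized
    binomial.\<close>
  have "(-1) ^ (k - j) * of_nat ((d - j) choose (k - j))
      = ((of_nat k - of_nat d - 1 :: 'a) gchoose (k - j))" if "j \<le> k" for j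
    using that assms gbinomial_negated_upper[of "of_nat k - of_nat d - 1 :: 'a" "k - j"]
    by (simp add: binomial_gbinomial of_nat_diff)
  then have "(\<Sum>j=0..k. (-1) ^ (k - j) * of_nat ((d - j) choose (k - j)) * of_nat (N choose j))
      = (\<Sum>j=0..k. (of_nat N gchoose j) * ((of_nat k - of_nat d - 1 :: 'a) gchoose (k - j)))"
    by (intro sum.cong) (auto simp: binomial_gbinomial)
  also have "\<dots> = (of_nat N + (of_nat k - of_nat d - 1)) gchoose k"
    by (rule gbinomial_Vandermonde)
  finally show ?thesis
    by (simp add: algebra_simps)
qed

text \<open>Comparison with the whole ring: full binomial coefficients in place of
  \<open>alpha\<close> give the closed form, and the only correction, in degree
  \<open>card L\<close>, is at least the product of the sizes. The generalized binomial also covers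
  \<open>d > p\<close>, where its upper entry can be negative.\<close>

lemma beta_intersection_of_disjoint_primes_le:
  fixes F :: "nat \<Rightarrow> nat set" and L :: "nat set"
  assumes L: "finite L" and F: "\<And>i. i \<in> L \<Longrightarrow> F i \<subseteq> {1..p}"
    and disj: "disjoint_family_on F L" and d: "card L \<le> d"
  shows "rat_of_int (beta p (carrier (polynomial_ring p :: 'k::field mpoly ring))
             (\<Inter>i\<in>L. Idl\<^bsub>polynomial_ring p\<^esub> (X ` F i)) d (card L))
       \<le> ((rat_of_nat p - rat_of_nat d + rat_of_nat (card L) - 1) gchoose card L)
           - rat_of_nat (\<Prod>i\<in>L. card (F i))"
proof -
  define a where "a = alpha p (carrier (polynomial_ring p :: 'k mpoly ring))
             (\<Inter>i\<in>L. Idl\<^bsub>polynomial_ring p\<^esub> (X ` F i))"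
  define r where "r = card L"
  have a: "a j = card {T. T \<subseteq> {1..p} \<and> card T = j \<and> (\<exists>i\<in>L. T \<inter> F i = {})}" for j
    unfolding a_def using F by (rule alpha_intersection_of_primes)
  \<comment> \<open>A set of fewer than \<open>r\<close> points cannot meet \<open>r\<close>
    disjoint sets, so missing some \<open>F i\<close> is automatic.\<close>
  have less: "a j = p choose j" if "j < r" for j
  proof -
    have "\<exists>i\<in>L. T \<inter> F i = {}" if T: "T \<subseteq> {1..p}" "card T = j" for T
    proof (rule ccontr)
      assume "\<not> (\<exists>i\<in>L. T \<inter> F i = {})"
      then have "card L \<le> card T"
        using T by (intro card_ge_if_meets_disjoint[OF L _ disj]) (auto intro: finite_subset)
      then show False
        using T \<open>j < r\<close> by (simp add: r_def)
    qed
    then have "{T. T \<subseteq> {1..p} \<and> card T = j \<and> (\<exists>i\<in>L. T \<inter> F i = {})}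
        = {T. T \<subseteq> {1..p} \<and> card T = j}"
      by blast
    then show ?thesis
      by (simp add: a n_subsets)
  qed
  \<comment> \<open>The sets of size \<open>r\<close> split into those missing some
    \<open>F i\<close> and the transversals, of which there are at least as many as the
    product.\<close>
  have le: "a r + (\<Prod>i\<in>L. card (F i)) \<le> p choose r"
  proof -
    let ?U = "{T. T \<subseteq> {1..p} \<and> card T = r \<and> (\<exists>i\<in>L. T \<inter> F i = {})}"
    let ?V = "{T. T \<subseteq> {1..p} \<and> card T = r \<and> (\<forall>i\<in>L. T \<inter> F i \<noteq> {})}"
    have "card {T. T \<subseteq> {1..p} \<and> card T = r} = card (?U \<union> ?V)"
      by (rule arg_cong[where f = card]) blast
    also have "\<dots> = card ?U + card ?V"
      by (rule card_Un_disjoint) auto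
    finally have "p choose r = a r + card ?V"
      by (simp add: a n_subsets)
    then show ?thesis
      using card_transversals_ge[where F = F and A = "{1..p}", OF L _ disj F] by (simp add: r_def)
  qed
  have "rat_of_int (beta p (carrier (polynomial_ring p :: 'k mpoly ring))
             (\<Inter>i\<in>L. Idl\<^bsub>polynomial_ring p\<^esub> (X ` F i)) d r)
      = (\<Sum>j=0..r. (-1) ^ (r - j) * of_nat ((d - j) choose (r - j)) * of_nat (a j))"
    by (simp add: beta_def a_def)
  \<comment> \<open>Only the last term can differ from its binomial counterpart. Its coefficient is
    \<open>(d - r) choose 0 = 1\<close>, so the bound on \<open>a r\<close> passes to the sum
    unchanged.\<close>
  also have "\<dots> = (\<Sum>j=0..<r. (-1) ^ (r - j) * of_nat ((d - j) choose (r - j)) * of_nat (p choose j))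
      + of_nat (a r)"
    by (simp add: less flip: atLeastLessThanSuc_atLeastAtMost)
  also have "\<dots> \<le> (\<Sum>j=0..<r. (-1) ^ (r - j) * of_nat ((d - j) choose (r - j)) * of_nat (p choose j))
      + of_nat (p choose r) - rat_of_nat (\<Prod>i\<in>L. card (F i))"
    using le by (simp add: le_diff_eq flip: of_nat_add of_nat_prod)
  also have "\<dots> = (\<Sum>j=0..r. (-1) ^ (r - j) * of_nat ((d - j) choose (r - j)) * of_nat (p choose j))
      - rat_of_nat (\<Prod>i\<in>L. card (F i))"
    by (simp flip: atLeastLessThanSuc_atLeastAtMost)
  also have "\<dots> = ((rat_of_nat p - rat_of_nat d + rat_of_nat r - 1) gchoose r)
      - rat_of_nat (\<Prod>i\<in>L. card (F i))"
    using d by (subst alternating_binomial_convolution) (simp_all add: r_def)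
  finally show ?thesis
    by (simp add: r_def)
qed

section \<open>The consecutive blocks of variables\<close>

lemma card_block: "1 \<le> i \<Longrightarrow> card (block n i) = n i"
  \<comment> \<open>For \<open>i = 0\<close> the block is empty whatever \<open>n 0\<close> is, so
    indices start at 1.\<close>
  by (cases i) (simp_all add: block_def atLeastLessThanSuc_atLeastAtMost)

lemma block_subset:
  assumes "i \<le> r"
  shows "block n i \<subseteq> {1..\<Sum>l=1..r. n l}"
proof -
  have "(\<Sum>l=1..i. n l) \<le> (\<Sum>l=1..r. n l)"
    using assms by (intro sum_mono2) auto
  then show ?thesis
    by (auto simp: block_def)
qed

lemma disjoint_family_block: "disjoint_family_on (block n) L"
proof -
  have "block n i \<inter> block n j = {}" if "i < j" for i j
  proof -
    have "(\<Sum>l=1..i. n l) \<le> (\<Sum>l=1..<j. n l)"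
      using that by (intro sum_mono2) auto
    then show ?thesis
      by (auto simp: block_def)
  qed
  then show ?thesis
    unfolding disjoint_family_on_def by (metis Int_commute linorder_neqE_nat)
qed

section \<open>The least \<open>d\<close> of the bound and the sign of \<open>beta\<close>\<close>

theorem proposition3p10:
  fixes r N :: nat and n :: "nat \<Rightarrow> nat"
    and S :: "('k::field) mpoly ring" and I :: "'k mpoly set"
  assumes "r \<ge> 1"
    and "\<forall>i\<in>{1..r}. n i \<ge> 1"
    and "N = (\<Sum>i=1..r. n i)"
    and "S = polynomial_ring N"
    and "I = (\<Inter>i\<in>{1..r}. Idl\<^bsub>S\<^esub> (X ` block n i))"
  shows "int (hdepth N (carrier S) I)
    \<le> (LEAST d::int. d \<ge> int r \<and>
          (rat_of_int (int N - d + int r - 1) gchoose r) < rat_of_nat (\<Prod>i=1..r. n i)) - 1"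
proof -
  \<comment> \<open>The condition over the natural numbers. Beyond \<open>N\<close> the truncated
    \<open>N - d\<close> can make it disagree with the integer version, so the two are compared only
    for \<open>d \<le> N\<close>.\<close>
  define Q where "Q d \<longleftrightarrow> r \<le> d \<and> (N - d + r - 1) choose r < (\<Prod>i=1..r. n i)" for d
  have Q_iff: "Q d \<longleftrightarrow> int d \<ge> int r \<and>
      (rat_of_int (int N - int d + int r - 1) gchoose r) < rat_of_nat (\<Prod>i=1..r. n i)"
    if "d \<le> N" for d
  proof -
    have "rat_of_int (int N - int d + int r - 1) = rat_of_nat (N - d + r - 1)"
      using that \<open>r \<ge> 1\<close> by (simp add: of_nat_diff)
    then show ?thesis
      unfolding Q_def by (simp only: of_nat_le_iff of_nat_less_iff flip: binomial_gbinomial)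
  qed
  have "(\<Sum>i=1..r. 1) \<le> (\<Sum>i=1..r. n i)"
    using assms(2) by (intro sum_mono) auto
  then have "r \<le> N"
    using assms(3) by simp
  moreover have "0 < (\<Prod>i=1..r. n i)"
    using assms(2) by (intro prod_pos) fastforce
  \<comment> \<open>At \<open>d = N\<close> the binomial is \<open>(r - 1) choose r = 0\<close>,
    below the positive product. So the minimum exists and is at most \<open>N\<close>.\<close>
  ultimately have "Q N"
    using \<open>r \<ge> 1\<close> by (simp add: Q_def binomial_eq_0)
  define e where "e = (LEAST d. Q d)"
  have "Q e" "e \<le> N"
    unfolding e_def using \<open>Q N\<close> by (rule LeastI, rule Least_le)
  \<comment> \<open>An integer candidate is at least \<open>r\<close>, hence natural. Up to
    \<open>N\<close> it satisfies \<open>Q\<close>; beyond \<open>N\<close> it exceeds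
    \<open>e\<close> anyway.\<close>
  have Least: "(LEAST d::int. d \<ge> int r \<and>
      (rat_of_int (int N - d + int r - 1) gchoose r) < rat_of_nat (\<Prod>i=1..r. n i)) = int e"
  proof (rule Least_equality)
    show "int e \<ge> int r \<and>
        (rat_of_int (int N - int e + int r - 1) gchoose r) < rat_of_nat (\<Prod>i=1..r. n i)"
      using \<open>Q e\<close> Q_iff[OF \<open>e \<le> N\<close>] by blast
    fix d :: int
    assume d: "d \<ge> int r \<and>
        (rat_of_int (int N - d + int r - 1) gchoose r) < rat_of_nat (\<Prod>i=1..r. n i)"
    then obtain d' where d': "d = int d'"
      by (metis nonneg_int_cases of_nat_0_le_iff order_trans)
    show "int e \<le> d"
    proof (cases "d' \<le> N")
      case True
      then have "Q d'"
        using d Q_iff[OF True] unfolding d' by blast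
      then show ?thesis
        unfolding d' e_def by (simp add: Least_le)
    next
      case False
      then show ?thesis
        using \<open>e \<le> N\<close> d' by simp
    qed
  qed
  \<comment> \<open>The depth is a maximum over a set that need not be an initial segment a priori,
    so every \<open>d\<close> from \<open>e\<close> to \<open>N\<close> has to be excluded.
    Monotonicity of the binomial in its upper entry carries \<open>Q\<close> from \<open>e\<close>
    to all of them.\<close>
  have neg: "beta N (carrier S) I d r < 0" if "e \<le> d" "d \<le> N" for d
  proof -
    have "(N - d + r - 1) choose r \<le> (N - e + r - 1) choose r"
      using that by (intro binomial_right_mono) auto
    then have "Q d"
      using \<open>Q e\<close> that by (simp add: Q_def)
    have "rat_of_int (beta N (carrier S) I d r)
        \<le> ((rat_of_nat N - rat_of_nat d + rat_of_nat r - 1) gchoose r)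
           - rat_of_nat (\<Prod>i=1..r. card (block n i))"
      using beta_intersection_of_disjoint_primes_le[OF _ _ disjoint_family_block,
          of "{1..r}" n N d, where 'k = 'k]
        block_subset[of _ r n] \<open>Q d\<close> assms(3) unfolding assms(4,5) Q_def by simp
    also have "\<dots> < 0"
      using \<open>Q d\<close> that(2) by (simp add: Q_iff card_block)
    finally show ?thesis
      by simp
  qed
  let ?D = "{d \<in> {0..N}. \<forall>k\<in>{0..d}. beta N (carrier S) I d k \<ge> 0}"
  \<comment> \<open>For \<open>d = 0\<close> the only value tested is \<open>alpha\<close> in degree
    0, a cardinality. The maximum is thus attained.\<close>
  have "0 \<in> ?D"
    by (simp add: beta_def)
  then have "hdepth N (carrier S) I \<in> ?D"
    unfolding hdepth_def by (intro Max_in) auto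
  \<comment> \<open>Otherwise \<open>r \<le> e \<le> hdepth N (carrier S) I\<close>, so the index
    \<open>k = r\<close> would be among those tested, against \<open>neg\<close>.\<close>
  then have "hdepth N (carrier S) I < e"
    using neg \<open>Q e\<close> by (fastforce simp: Q_def not_less[symmetric])
  then show ?thesis
    unfolding Least by simp
qed

end
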